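(* Let $\mathcal{U}\times\mathcal{V}\subseteq\mathbb{R}^n\times\mathbb{R}^n$ be an open neighborhood of the origin, and let $f:\mathcal{U}\times\mathcal{V}\to\mathbb{R}^n$ be of class $C^1$ with $f(0,0)=0$. Put $A_f:=\frac{\partial f}{\partial x}|_{(0,0)}$ and $B_f:=\frac{\partial f}{\partial u}|_{(0,0)}$. Suppose $\mathrm{cov} f(0,0)>0$ and that $f$ satisfies a transversality condition at the origin, i.e. there is $c\ge 0$ with $A_f=-cB_f$. Then $\dot x=f(x,u)$ is locally exponentially stabilizable by means of continuously differentiable stationary feedback laws. Moreover, with $c$ the transversality constant of $f$ at the origin, this stability is achieved by the linear feedback law $$u(x)=-(c^2+1)B_f^*\left(A_fA_f^*+B_fB_f^*\right)^{-1}(I+A_f)x.$$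
   Context: All norms are Euclidean; $\mathbb{B}_r(z)$ is the closed ball of radius $r$ centered at $z$; $A^*$ is the transpose of a real matrix $A$. Linear openness: a mapping $g$ into $\mathbb{R}^n$ defined near $\bar z\in\mathbb{R}^\ell$ is linearly open around $\bar z$ with modulus $\kappa>0$ if there is a neighborhood $\mathcal{W}$ of $\bar z$ such that $\mathbb{B}_{\kappa r}(g(z))\subseteq g(\mathbb{B}_r(z))$ for all $z\in\mathcal{W}$ and $r>0$ with $\mathbb{B}_r(z)\subseteq\mathcal{W}$. $\mathrm{cov}\,g(\bar z)$ denotes the supremum of all such moduli $\kappa$, with $\mathrm{cov}\,g(\bar z):=0$ if $g$ is not linearly open around $\bar z$ for any modulus. A constant $c\ge 0$ with $A_f=-cB_f$ is called the transversality constant of $f$ at the origin. The system $\dot x=f(x,u)$ is locally exponentially stabilizable by means of continuously differentiable stationary feedback laws if there exist a $C^1$ feedback $\bar u(x)$ defined near $0\in\mathbb{R}^n$ with $\bar u(0)=0$ and constants $\alpha,M,\delta>0$ such that for every $x_0$ with $\|x_0\|<\delta$ there is a unique solution $\phi(t,x_0)$ of $\dot x=f(x,\bar u(x))$ with $\phi(0,x_0)=x_0$, and $\|\phi(t,x_0)\|\le M\|x_0\|e^{-\alpha t}$ for all $t\ge 0$. *)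

theory Defs
  imports "HOL-Analysis.Analysis"
begin

definition C1_on :: "'a::real_normed_vector set \<Rightarrow> ('a \<Rightarrow> 'b::real_normed_vector) \<Rightarrow> bool" where
  "C1_on S g \<longleftrightarrow>
    (\<exists>g' :: 'a \<Rightarrow> 'a \<Rightarrow>\<^sub>L 'b.
      (\<forall>z\<in>S. (g has_derivative blinfun_apply (g' z)) (at z)) \<and> continuous_on S g')"

(* HOL functions are total, so partially defined maps come with their domain:
   D is the set on which g is regarded as defined. *)
definition linearly_open_around ::
    "'a::metric_space set \<Rightarrow> ('a \<Rightarrow> 'b::metric_space) \<Rightarrow> 'a \<Rightarrow> real \<Rightarrow> bool" where
  "linearly_open_around D g zb \<kappa> \<longleftrightarrow>
    (\<exists>W. open W \<and> zb \<in> W \<and> W \<subseteq> D \<and>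
      (\<forall>z\<in>W. \<forall>r>0. cball z r \<subseteq> W \<longrightarrow> cball (g z) (\<kappa> * r) \<subseteq> g ` cball z r))"

(* Extended-real valued, since the set of moduli need not be bounded for an arbitrary g. *)
definition cov :: "'a::metric_space set \<Rightarrow> ('a \<Rightarrow> 'b::metric_space) \<Rightarrow> 'a \<Rightarrow> ereal" where
  "cov D g zb =
    (if \<exists>\<kappa>>0. linearly_open_around D g zb \<kappa>
     then SUP \<kappa>\<in>{\<kappa>. \<kappa> > 0 \<and> linearly_open_around D g zb \<kappa>}. ereal \<kappa>
     else 0)"

definition jac_state :: "((real^'n) \<times> (real^'m) \<Rightarrow> real^'n) \<Rightarrow> real^'n^'n" where
  "jac_state f = jacobian (\<lambda>x. f (x, 0)) (at 0)"

definition jac_control :: "((real^'n) \<times> (real^'m) \<Rightarrow> real^'n) \<Rightarrow> real^'m^'n" where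
  "jac_control f = jacobian (\<lambda>u. f (0, u)) (at 0)"

definition transversality_constant :: "((real^'n) \<times> (real^'n) \<Rightarrow> real^'n) \<Rightarrow> real \<Rightarrow> bool" where
  "transversality_constant f c \<longleftrightarrow> c \<ge> 0 \<and> jac_state f = - c *\<^sub>R jac_control f"

(* The trajectory has to stay in the domain D of the vector field F. Derivatives are taken
   within J, hence are one-sided at an endpoint contained in J. *)
definition solves_ivp ::
    "('a::real_normed_vector \<Rightarrow> 'a) \<Rightarrow> 'a set \<Rightarrow> real set \<Rightarrow> 'a \<Rightarrow> (real \<Rightarrow> 'a) \<Rightarrow> bool" where
  "solves_ivp F D J x0 \<phi> \<longleftrightarrow>
    \<phi> 0 = x0 \<and>
    (\<forall>t\<in>J. \<phi> t \<in> D \<and> (\<phi> has_vector_derivative F (\<phi> t)) (at t within J))"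

(* Here f is regarded as defined on U \<times> V and the feedback w as defined on N, so the closed-loop
   field x \<mapsto> f (x, w x) lives on {x \<in> N \<inter> U. w x \<in> V}. Uniqueness is also required of solutions
   that exist only on a bounded interval [0,T). *)
definition exp_stabilizing_feedback ::
    "'a::real_normed_vector set \<Rightarrow> 'b::real_normed_vector set \<Rightarrow> ('a \<times> 'b \<Rightarrow> 'a) \<Rightarrow>
      'a set \<Rightarrow> ('a \<Rightarrow> 'b) \<Rightarrow> bool" where
  "exp_stabilizing_feedback U V f N w \<longleftrightarrow>
    open N \<and> 0 \<in> N \<and> C1_on N w \<and> w 0 = 0 \<and>
    (let F = (\<lambda>x. f (x, w x)); D = {x \<in> N \<inter> U. w x \<in> V} in
      \<exists>\<alpha>>0. \<exists>M>0. \<exists>\<delta>>0. \<forall>x0. norm x0 < \<delta> \<longrightarrow>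
        (\<exists>\<phi>. solves_ivp F D {0..} x0 \<phi> \<and>
          (\<forall>T>0. \<forall>\<psi>. solves_ivp F D {0..<T} x0 \<psi> \<longrightarrow> (\<forall>t\<in>{0..<T}. \<psi> t = \<phi> t)) \<and>
          (\<forall>t\<ge>0. norm (\<phi> t) \<le> M * norm x0 * exp (- \<alpha> * t))))"

definition locally_exp_stabilizable ::
    "'a::real_normed_vector set \<Rightarrow> 'b::real_normed_vector set \<Rightarrow> ('a \<times> 'b \<Rightarrow> 'a) \<Rightarrow> bool" where
  "locally_exp_stabilizable U V f \<longleftrightarrow> (\<exists>N w. exp_stabilizing_feedback U V f N w)"

end

theory Submission
  imports Defs
begin

text \<open>Linear openness forces the derivative of \<open>f\<close> at the origin to be surjective, so the
  transversality condition makes \<open>B\<close> invertible. Then \<open>A A\<^sup>* + B B\<^sup>* = (c\<^sup>2 + 1) B B\<^sup>*\<close>, the feedback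
  is \<open>u x = - B\<^sup>-\<^sup>1 (I + A) x\<close>, and the closed-loop field has derivative \<open>- I\<close> at the origin. Hence it
  is \<open>F x = - x + R x\<close> where \<open>R\<close> has a small Lipschitz constant near the origin. Substituting
  \<open>\<phi> t = exp (- t / 2) y t\<close> into the variation-of-constants formula makes it a contraction on a
  ball of bounded continuous functions \<open>y\<close>, which yields existence and exponential decay at once.\<close>

section \<open>Linear openness and surjectivity of the derivative\<close>

text \<open>If the range of \<open>L\<close> were proper, a unit vector \<open>y\<close> orthogonal
  to it would exist. Openness produces a point \<open>x\<close> within \<open>r\<close> of
  \<open>z\<close> whose value is displaced by exactly \<open>\<kappa> * r\<close> along
  \<open>y\<close>. The linear part contributes nothing in that direction, so the whole displacement
  must come from the first-order remainder, which is at most half as large for small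
  \<open>r\<close>.\<close>

lemma linearly_open_imp_surj_derivative:
  fixes g :: "'a::real_normed_vector \<Rightarrow> 'b::euclidean_space"
  assumes lo: "linearly_open_around D g z \<kappa>" and "\<kappa> > 0"
    and der: "(g has_derivative L) (at z)"
  shows "surj L"
proof (rule ccontr)
  assume "\<not> surj L"
  have lin: "linear L" using der by (rule has_derivative_linear)
  have "subspace (range L)"
    using lin by (simp add: linear_subspace_image)
  then have "span (range L) \<subset> span UNIV"
    using \<open>\<not> surj L\<close> by (metis psubsetI span_UNIV span_eq_iff subset_UNIV)
  then obtain y0 where "y0 \<noteq> 0" and y0: "\<And>v. v \<in> span (range L) \<Longrightarrow> orthogonal y0 v"
    by (rule orthogonal_to_subspace_exists_gen) auto
  define y where "y = y0 /\<^sub>R norm y0"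
  have ny: "norm y = 1" using \<open>y0 \<noteq> 0\<close> by (simp add: y_def)
  have yL: "y \<bullet> L h = 0" for h
    using y0[of "L h"] by (simp add: y_def orthogonal_def span_base)
  obtain W where W: "open W" "z \<in> W"
    and WC: "\<forall>x\<in>W. \<forall>r>0. cball x r \<subseteq> W \<longrightarrow> cball (g x) (\<kappa> * r) \<subseteq> g ` cball x r"
    using lo unfolding linearly_open_around_def by (elim exE conjE) (rule that)
  obtain d where d: "d > 0" and dd: "\<And>x. norm (x - z) < d \<Longrightarrow>
      norm (g x - g z - L (x - z)) \<le> \<kappa> / 2 * norm (x - z)"
    using der \<open>\<kappa> > 0\<close> unfolding has_derivative_at_alt by (meson half_gt_zero)
  obtain e where e: "e > 0" "cball z e \<subseteq> W"
    using W by (meson open_contains_cball)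
  define r where "r = min e (d / 2)"
  have r: "r > 0" "r < d" "cball z r \<subseteq> W"
    using e d by (auto simp: r_def)
  have "g z + (\<kappa> * r) *\<^sub>R y \<in> cball (g z) (\<kappa> * r)"
    using \<open>\<kappa> > 0\<close> r(1) by (simp add: dist_norm ny)
  then obtain x where x: "x \<in> cball z r" "g x = g z + (\<kappa> * r) *\<^sub>R y"
    using WC W(2) r(1,3) by (metis imageE subsetD)
  have nx: "norm (x - z) \<le> r" using x(1) by (simp add: dist_norm norm_minus_commute)
  have "\<kappa> * r = y \<bullet> (g x - g z - L (x - z))"
    using ny by (simp add: x(2) yL inner_diff_right norm_eq_1)
  also have "\<dots> \<le> norm (g x - g z - L (x - z))"
    using norm_cauchy_schwarz[of y "g x - g z - L (x - z)"] ny by simp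
  also have "\<dots> \<le> \<kappa> / 2 * norm (x - z)" using dd nx r(2) by auto
  also have "\<dots> \<le> \<kappa> / 2 * r" using nx \<open>\<kappa> > 0\<close> by simp
  finally show False using \<open>\<kappa> > 0\<close> r(1) by simp
qed

lemma cov_pos_iff: "cov D g z > 0 \<longleftrightarrow> (\<exists>\<kappa>>0. linearly_open_around D g z \<kappa>)"
proof
  show "\<exists>\<kappa>>0. linearly_open_around D g z \<kappa>" if "cov D g z > 0"
    using that unfolding cov_def by (auto split: if_splits)
next
  assume ex: "\<exists>\<kappa>>0. linearly_open_around D g z \<kappa>"
  then obtain \<kappa> where "\<kappa> > 0" "linearly_open_around D g z \<kappa>" by blast
  then show "cov D g z > 0"
    using ex unfolding cov_def by (auto simp: less_SUP_iff)
qed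

section \<open>Solutions near the equilibrium: existence, decay and uniqueness\<close>

text \<open>This bounds the integral term of the variation-of-constants formula. Its growth of order
  \<open>exp (t / 2)\<close> is what the damping factor in \<open>P\<close> below cancels, uniformly
  in \<open>t\<close>.\<close>

lemma norm_integral_le_exp:
  fixes g :: "real \<Rightarrow> 'a::euclidean_space"
  assumes "t \<ge> 0" "continuous_on {0..t} g"
    and "\<And>s. s \<in> {0..t} \<Longrightarrow> norm (g s) \<le> c * exp (s / 2)"
  shows "norm (integral {0..t} g) \<le> 2 * c * (exp (t / 2) - 1)"
proof -
  have "((\<lambda>s. c * exp (s / 2)) has_integral (2 * c * exp (t / 2) - 2 * c * exp (0 / 2))) {0..t}"
    using assms(1)
    by (intro fundamental_theorem_of_calculus)
      (auto intro!: derivative_eq_intros simp flip: has_real_derivative_iff_has_vector_derivative)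
  then have "integral {0..t} (\<lambda>s. c * exp (s / 2)) = 2 * c * (exp (t / 2) - 1)"
    and "(\<lambda>s. c * exp (s / 2)) integrable_on {0..t}"
    by (auto simp: algebra_simps integrable_on_def dest: integral_unique)
  then show ?thesis
    using integral_norm_bound_integral[of g "{0..t}" "\<lambda>s. c * exp (s / 2)"] assms
    by (simp del: integral_mult_right add: integrable_continuous_real)
qed

text \<open>The constants fit together as follows: integrating \<open>exp (s / 2)\<close> costs a
  factor 2, so the Lipschitz constant 1/4 of the nonlinear part becomes the contraction constant
  1/2. The decay rate 1/2 is half the rate of the linear part \<open>- x\<close>.\<close>

lemma exists_decaying_solution:
  fixes F :: "'a::euclidean_space \<Rightarrow> 'a"
  assumes F0: "F 0 = 0"
    and lip: "\<And>x y. x \<in> cball 0 \<rho> \<Longrightarrow> y \<in> cball 0 \<rho> \<Longrightarrow>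
      norm ((F x + x) - (F y + y)) \<le> 1 / 4 * norm (x - y)"
    and x0: "2 * norm x0 \<le> \<rho>"
  obtains \<phi> where "\<phi> 0 = x0"
    and "\<And>t. t \<ge> 0 \<Longrightarrow> (\<phi> has_vector_derivative F (\<phi> t)) (at t within {0..})"
    and "\<And>t. t \<ge> 0 \<Longrightarrow> norm (\<phi> t) \<le> 2 * norm x0 * exp (- t / 2)"
proof -
  define R where "R x = F x + x" for x
  \<comment> \<open>The radius leaves one half for the contribution of the initial value and the
    other half for the contraction, so that the ball is mapped into itself.\<close>
  define r where "r = 2 * norm x0"
  have R0: "R 0 = 0" by (simp add: R_def F0)
  have r: "0 \<le> r" "r \<le> \<rho>" using x0 by (auto simp: r_def)
  have Rlip: "norm (R x - R y) \<le> 1 / 4 * norm (x - y)"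
    if "x \<in> cball 0 r" "y \<in> cball 0 r" for x y
    using lip that r by (force simp: R_def)
  have Rcont: "continuous_on (cball 0 r) R"
    by (rule lipschitz_on_continuous_on[of "1/4"])
      (use Rlip in \<open>auto simp: lipschitz_on_def dist_norm\<close>)
  define S :: "(real \<Rightarrow>\<^sub>C 'a) set" where "S = cball 0 r"
  \<comment> \<open>This is the integrand \<open>exp s *\<^sub>R R (\<phi> s)\<close> of the
    variation-of-constants formula after substituting \<open>exp (- s / 2) *\<^sub>R y s\<close> for
    \<open>\<phi> s\<close>.\<close>
  define G where "G y s = exp s *\<^sub>R R (exp (- s / 2) *\<^sub>R apply_bcontfun y s)"
    for y :: "real \<Rightarrow>\<^sub>C 'a" and s
  have Sr: "norm (apply_bcontfun y s) \<le> r" if "y \<in> S" for y s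
    using that norm_bounded[of y s] by (auto simp: S_def)
  have in_cball: "exp (- s / 2) *\<^sub>R apply_bcontfun y s \<in> cball 0 r" if "y \<in> S" "s \<ge> 0" for y s
  proof -
    have "exp (- s / 2) * norm (apply_bcontfun y s) \<le> 1 * r"
      using that Sr by (intro mult_mono) auto
    then show ?thesis by simp
  qed
  have Gcont: "continuous_on {0..} (G y)" if "y \<in> S" for y
    unfolding G_def
    by (intro continuous_intros continuous_on_compose2[OF Rcont])
      (use in_cball[OF that] in auto)
  have Gdiff: "norm (G y s - G z s) \<le> dist y z / 4 * exp (s / 2)"
    if "y \<in> S" "z \<in> S" "s \<ge> 0" for y z s
  proof -
    have "norm (G y s - G z s) = exp s * norm (R (exp (- s / 2) *\<^sub>R apply_bcontfun y s)
        - R (exp (- s / 2) *\<^sub>R apply_bcontfun z s))"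
      by (simp add: G_def flip: scaleR_diff_right)
    also have "\<dots> \<le> exp s * (1 / 4 * norm (exp (- s / 2) *\<^sub>R apply_bcontfun y s
        - exp (- s / 2) *\<^sub>R apply_bcontfun z s))"
      using Rlip in_cball that by (intro mult_left_mono) auto
    also have "\<dots> = exp (s / 2) * norm (apply_bcontfun y s - apply_bcontfun z s) / 4"
      by (simp flip: scaleR_diff_right mult.assoc exp_add)
    also have "\<dots> \<le> exp (s / 2) * dist y z / 4"
      using dist_bounded[of y s z] by (simp add: dist_norm)
    finally show ?thesis by (simp add: mult.commute)
  qed
  have zS: "0 \<in> S" using r by (simp add: S_def)
  have G0: "G 0 = (\<lambda>s. 0)" by (simp add: fun_eq_iff G_def R0)
  have Gbd: "norm (G y s) \<le> r / 4 * exp (s / 2)" if "y \<in> S" "s \<ge> 0" for y s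
  proof -
    have "norm (G y s) \<le> dist y 0 / 4 * exp (s / 2)"
      using Gdiff[OF that(1) zS that(2)] by (simp add: G0)
    also have "\<dots> \<le> r / 4 * exp (s / 2)" using that by (simp add: S_def dist_commute)
    finally show ?thesis .
  qed
  define I where "I y t = integral {0..t} (G y)" for y t
  \<comment> \<open>The formula reads \<open>\<phi> t = exp (- t) *\<^sub>R (x0 + I y t)\<close>;
    multiplying by \<open>exp (t / 2)\<close> turns it into the fixed-point equation
    \<open>y = P y\<close> on nonnegative times.\<close>
  define P where "P y t = exp (- t / 2) *\<^sub>R (x0 + I y t)" for y t
  have Ider: "(I y has_vector_derivative G y t) (at t within {0..})" if "y \<in> S" "t \<ge> 0" for y t
  proof -
    \<comment> \<open>Ending the interval at \<open>t + 1\<close> leaves room to the right of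
      \<open>t\<close>, so the derivative within it agrees with the one within the
      half-line.\<close>
    have "(I y has_vector_derivative G y t) (at t within {0..t + 1})"
      unfolding I_def using that
      by (intro integral_has_vector_derivative continuous_on_subset[OF Gcont]) auto
    moreover have "at t within {0..t + 1} = at t within {0..}"
      using that by (intro at_within_nhd[of t "{..<t + 1}"]) auto
    ultimately show ?thesis by simp
  qed
  have Pcont: "continuous_on {0..} (P y)" if "y \<in> S" for y
  proof -
    have "continuous_on {0..} (I y)"
      by (meson Ider[OF that] atLeast_iff has_vector_derivative_continuous
          continuous_on_eq_continuous_within)
    then show ?thesis unfolding P_def by (intro continuous_intros) auto
  qed
  have Pdiff: "norm (P y t - P z t) \<le> dist y z / 2" if "y \<in> S" "z \<in> S" "t \<ge> 0" for y z t
  proof -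
    have c: "continuous_on {0..t} (G y)" "continuous_on {0..t} (G z)"
      using that by (auto intro: continuous_on_subset[OF Gcont])
    have "P y t - P z t = exp (- t / 2) *\<^sub>R integral {0..t} (\<lambda>s. G y s - G z s)"
      using c by (simp add: P_def I_def integral_diff integrable_continuous_real
          flip: scaleR_diff_right)
    moreover have "norm (integral {0..t} (\<lambda>s. G y s - G z s))
        \<le> 2 * (dist y z / 4) * (exp (t / 2) - 1)"
      using that c Gdiff by (intro norm_integral_le_exp continuous_intros) auto
    ultimately have "norm (P y t - P z t)
        \<le> exp (- t / 2) * (2 * (dist y z / 4) * (exp (t / 2) - 1))"
      by simp
    also have "\<dots> = dist y z / 2 * (1 - exp (- t / 2))"
      by (simp add: algebra_simps flip: exp_add)
    also have "\<dots> \<le> dist y z / 2 * 1" by (intro mult_left_mono) auto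
    finally show ?thesis by simp
  qed
  have Pbd: "norm (P y t) \<le> r" if "y \<in> S" "t \<ge> 0" for y t
  proof -
    have "norm (P 0 t) \<le> norm x0"
      using that by (simp add: P_def I_def G0 mult_left_le_one_le)
    moreover have "norm (P y t - P 0 t) \<le> r / 2"
      using Pdiff[OF that(1) zS that(2)] that(1) by (simp add: S_def dist_commute)
    ultimately show ?thesis
      using norm_triangle_sub[of "P y t" "P 0 t"] by (simp add: r_def)
  qed
  \<comment> \<open>Bounded continuous functions live on the whole line, whereas \<open>P y\<close>
    is controlled only for nonnegative times; \<open>max 0 t\<close> extends it to the left by a
    constant, which leaves sup-norm bounds unchanged.\<close>
  define Q where "Q y = Bcontfun (\<lambda>t. P y (max 0 t))" for y
  have Q: "apply_bcontfun (Q y) t = P y (max 0 t)" if "y \<in> S" for y t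
  proof -
    have "(\<lambda>t. P y (max 0 t)) \<in> bcontfun"
      using Pbd[OF that]
      by (intro bcontfun_normI[of _ r] continuous_on_compose2[OF Pcont[OF that]])
        (auto intro!: continuous_intros)
    then show ?thesis by (simp add: Q_def Bcontfun_inverse)
  qed
  have "\<exists>!y\<in>S. Q y = y"
  proof (rule Banach_fix[of S "1/2" Q])
    show "complete S" by (simp add: S_def complete_eq_closed)
    show "S \<noteq> {}" using zS by auto
    show "Q ` S \<subseteq> S"
    proof clarify
      fix y assume "y \<in> S"
      then have "norm (Q y) \<le> r" by (intro norm_bound) (auto simp: Q Pbd)
      then show "Q y \<in> S" by (simp add: S_def)
    qed
    show "dist (Q x) (Q y) \<le> 1 / 2 * dist x y" if "x \<in> S" "y \<in> S" for x y
      using that Pdiff by (intro dist_bound) (auto simp: Q dist_norm)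
  qed auto
  then obtain y where y: "y \<in> S" "Q y = y" by blast
  have yP: "apply_bcontfun y t = P y t" if "t \<ge> 0" for t
    using Q[OF y(1), of t] that y(2) by simp
  \<comment> \<open>The integral form makes differentiability visible; the fixed-point identity then
    shows that this is the damped \<open>y\<close>, which gives the decay.\<close>
  define \<phi> where "\<phi> t = exp (- t) *\<^sub>R (x0 + I y t)" for t
  have \<phi>y: "\<phi> t = exp (- t / 2) *\<^sub>R apply_bcontfun y t" if "t \<ge> 0" for t
    using that by (simp add: yP P_def \<phi>_def flip: exp_add)
  show thesis
  proof
    show "\<phi> 0 = x0" by (simp add: \<phi>_def I_def)
    show "(\<phi> has_vector_derivative F (\<phi> t)) (at t within {0..})" if "t \<ge> 0" for t
    proof -
      have "(\<phi> has_vector_derivative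
          (exp (- t) *\<^sub>R G y t + (- exp (- t)) *\<^sub>R (x0 + I y t))) (at t within {0..})"
        unfolding \<phi>_def using Ider[OF y(1) that]
        by (intro derivative_eq_intros) (auto intro!: derivative_eq_intros)
      moreover have "exp (- t) *\<^sub>R G y t = R (\<phi> t)"
        using that by (simp add: G_def \<phi>y flip: exp_add)
      ultimately show ?thesis by (simp add: R_def \<phi>_def)
    qed
    show "norm (\<phi> t) \<le> 2 * norm x0 * exp (- t / 2)" if "t \<ge> 0" for t
      using Sr[OF y(1), of t] that by (simp add: \<phi>y r_def)
  qed
qed

text \<open>The hypothesis on \<open>F\<close> is one-sided: it makes \<open>\<parallel>\<psi> - \<phi>\<parallel>\<^sup>2\<close> nonincreasing while both solutions
  are in \<open>S\<close>. Only \<open>\<phi>\<close> is known to stay there; were \<open>\<psi>\<close> to differ from it at \<open>t\<close>, the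
  contradiction arises just after the last time before \<open>t\<close> at which the two agree.\<close>

lemma solution_unique:
  fixes F :: "'a::real_inner \<Rightarrow> 'a"
  assumes mono: "\<And>x y. x \<in> S \<Longrightarrow> y \<in> S \<Longrightarrow> (x - y) \<bullet> (F x - F y) \<le> 0"
    and "open S"
    and \<phi>: "\<And>t. t \<in> {0..<T} \<Longrightarrow> \<phi> t \<in> S \<and> (\<phi> has_vector_derivative F (\<phi> t)) (at t within {0..<T})"
    and \<psi>: "\<And>t. t \<in> {0..<T} \<Longrightarrow> (\<psi> has_vector_derivative F (\<psi> t)) (at t within {0..<T})"
    and "\<psi> 0 = \<phi> 0" and t: "t \<in> {0..<T}"
  shows "\<psi> t = \<phi> t"
proof (rule ccontr)
  assume ne: "\<psi> t \<noteq> \<phi> t"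
  have cont: "continuous_on {0..<T} \<phi>" "continuous_on {0..<T} \<psi>"
    using \<phi> \<psi> by (meson has_vector_derivative_continuous continuous_on_eq_continuous_within)+
  define Z where "Z = {s \<in> {0..t}. \<psi> s - \<phi> s = 0}"
  have sub: "{0..t} \<subseteq> {0..<T}" using t by auto
  have "closed Z"
    unfolding Z_def using continuous_on_subset[OF cont(1) sub] continuous_on_subset[OF cont(2) sub]
    by (intro continuous_closed_preimage_constant continuous_intros) auto
  then have "compact Z"
    by (metis (no_types, lifting) Z_def compact_Icc compact_Int_closed inf.absorb2
        mem_Collect_eq subsetI)
  moreover have "Z \<noteq> {}" using t assms(5) by (auto simp: Z_def)
  ultimately obtain \<tau> where \<tau>: "\<tau> \<in> Z" "\<And>s. s \<in> Z \<Longrightarrow> s \<le> \<tau>"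
    by (meson compact_attains_sup)
  have \<tau>': "0 \<le> \<tau>" "\<tau> < t" "\<psi> \<tau> = \<phi> \<tau>"
    using \<tau>(1) ne by (auto simp: Z_def less_le)
  have "\<psi> \<tau> \<in> S" using \<phi>[of \<tau>] \<tau>' t by auto
  then obtain e where e: "e > 0" "ball (\<psi> \<tau>) e \<subseteq> S"
    using \<open>open S\<close> by (meson openE)
  obtain d where d: "d > 0" "\<And>s. s \<in> {0..<T} \<Longrightarrow> dist s \<tau> < d \<Longrightarrow> dist (\<psi> s) (\<psi> \<tau>) < e"
    using cont(2)[unfolded continuous_on_iff, rule_format, of \<tau> e] \<tau>' t e(1) by auto
  \<comment> \<open>Up to \<open>b\<close> the solution \<open>\<psi>\<close> stays within
    \<open>e\<close> of \<open>\<psi> \<tau>\<close>, hence in \<open>S\<close>, so the one-sided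
    condition applies between \<open>\<tau>\<close> and \<open>b\<close>.\<close>
  define b where "b = min t (\<tau> + d / 2)"
  have b: "\<tau> < b" "b \<le> t" "b < \<tau> + d" using d(1) \<tau>' by (auto simp: b_def min_def)
  define E where "E s = (\<psi> s - \<phi> s) \<bullet> (\<psi> s - \<phi> s)" for s
  have "E \<tau> \<ge> E b"
  proof (rule DERIV_nonpos_imp_decreasing_open[of \<tau> b E])
    show "\<tau> \<le> b" using b by simp
    show "continuous_on {\<tau>..b} E"
      unfolding E_def using \<tau>' b t
      by (intro continuous_intros continuous_on_subset[OF cont(1)] continuous_on_subset[OF cont(2)]) auto
    fix s assume s: "\<tau> < s" "s < b"
    have sT: "s \<in> {0<..<T}" using s b \<tau>' t by auto
    then have at: "at s within {0..<T} = at s"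
      by (intro at_within_interior) (simp add: interior_atLeastLessThan)
    have "\<psi> s \<in> S"
      using d(2)[of s] s b sT e(2) by (auto simp: dist_norm mem_ball norm_minus_commute subset_iff)
    then have le: "(\<psi> s - \<phi> s) \<bullet> (F (\<psi> s) - F (\<phi> s)) \<le> 0"
      using mono \<phi>[of s] sT by auto
    have "((\<lambda>s. \<psi> s - \<phi> s) has_vector_derivative F (\<psi> s) - F (\<phi> s)) (at s)"
      using \<phi>[of s] \<psi>[of s] sT by (auto simp: at intro!: has_vector_derivative_diff)
    from has_derivative_inner[OF this[unfolded has_vector_derivative_def]
        this[unfolded has_vector_derivative_def]]
    have "(E has_real_derivative 2 * ((\<psi> s - \<phi> s) \<bullet> (F (\<psi> s) - F (\<phi> s)))) (at s)"
      unfolding E_def has_field_derivative_def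
      by (rule has_derivative_eq_rhs) (simp add: fun_eq_iff inner_commute)
    then show "\<exists>y. (E has_real_derivative y) (at s) \<and> y \<le> 0" using le by force
  qed
  then have "\<psi> b - \<phi> b = 0" using \<tau>' inner_gt_zero_iff[of "\<psi> b - \<phi> b"]
    by (simp add: E_def del: inner_gt_zero_iff)
  then have "b \<in> Z" using b \<tau>' by (simp add: Z_def)
  then show False using \<tau>(2) b by force
qed

section \<open>From the linearized closed loop to exponential stability\<close>

text \<open>By \<open>id\<close>, the derivative of \<open>F x + x\<close> is
  \<open>f' (p x) - f' (0, 0)\<close> composed with \<open>p\<close>. Continuity of
  \<open>f'\<close> makes it small near the origin, and the mean value inequality on a ball turns
  this into a Lipschitz bound, which drives both existence and uniqueness.\<close>

lemma exp_stabilizing_feedback_if_derivative_minus_id: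
  fixes f :: "'a::euclidean_space \<times> 'b::real_normed_vector \<Rightarrow> 'a" and w :: "'a \<Rightarrow> 'b"
  assumes opn: "open (U \<times> V)" and mem: "(0, 0) \<in> U \<times> V"
    and der: "\<And>z. z \<in> U \<times> V \<Longrightarrow> (f has_derivative blinfun_apply (f' z)) (at z)"
    and cont: "continuous_on (U \<times> V) f'" and f0: "f (0, 0) = 0"
    and w: "bounded_linear w"
    and id: "\<And>h. blinfun_apply (f' (0, 0)) (h, w h) = - h"
  shows "exp_stabilizing_feedback U V f UNIV w"
proof -
  interpret w: bounded_linear w by (rule w)
  define F where "F x = f (x, w x)" for x
  define D where "D = {x \<in> UNIV \<inter> U. w x \<in> V}"
  define p where "p x = (x, w x)" for x
  have p: "bounded_linear p" unfolding p_def
    by (intro bounded_linear_Pair bounded_linear_ident w)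
  interpret p: bounded_linear p by (rule p)
  obtain K where K: "K > 0" "\<And>x. norm (p x) \<le> norm x * K"
    using p.pos_bounded by blast
  obtain e where e: "e > 0" "ball (0, 0) e \<subseteq> U \<times> V"
    using opn mem by (meson openE)
  obtain d where d: "d > 0" and
    \<comment> \<open>The factor \<open>K\<close> offsets the norm of \<open>p\<close>, so that the
      composed derivative is bounded by 1/4.\<close>
    dd: "\<And>z. z \<in> U \<times> V \<Longrightarrow> dist z (0, 0) < d \<Longrightarrow> dist (f' z) (f' (0, 0)) < 1 / (4 * K)"
    using cont mem K(1) unfolding continuous_on_iff
    by (metis zero_less_divide_1_iff zero_less_mult_iff zero_less_numeral)
  \<comment> \<open>The additional 2 keeps \<open>p x\<close> strictly within both radii even on the
    closed ball.\<close>
  define \<rho> where "\<rho> = min e d / (2 * K)"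
  have \<rho>: "\<rho> > 0" using e(1) d K(1) by (simp add: \<rho>_def)
  have pn: "norm (p x) < min e d" if "x \<in> cball 0 \<rho>" for x
  proof -
    have "norm (p x) \<le> norm x * K" by (rule K)
    also have "\<dots> \<le> \<rho> * K" using that K(1) by simp
    also have "\<dots> = min e d / 2" using K(1) by (simp add: \<rho>_def)
    also have "\<dots> < min e d" using e(1) d by (simp add: min_def)
    finally show ?thesis .
  qed
  have pm: "p x \<in> U \<times> V" "dist (p x) (0, 0) < d" if "x \<in> cball 0 \<rho>" for x
    using pn[OF that] subsetD[OF e(2), of "p x"] by (auto simp: dist_norm simp flip: zero_prod_def)
  have lip: "norm ((F x + x) - (F y + y)) \<le> 1 / 4 * norm (x - y)"
    if "x \<in> cball 0 \<rho>" "y \<in> cball 0 \<rho>" for x y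
  proof (rule differentiable_bound[OF convex_cball _ _ that])
    fix x :: 'a assume x: "x \<in> cball 0 \<rho>"
    have "((\<lambda>x. f (p x)) has_derivative (\<lambda>h. f' (p x) (p h))) (at x within cball 0 \<rho>)"
      using has_derivative_compose[OF p.has_derivative[OF has_derivative_ident] der[OF pm(1)[OF x]]] .
    then show "((\<lambda>x. F x + x) has_derivative (\<lambda>h. f' (p x) (p h) + h)) (at x within cball 0 \<rho>)"
      unfolding F_def p_def by (intro derivative_intros)
    show "onorm (\<lambda>h. f' (p x) (p h) + h) \<le> 1 / 4"
    proof (rule onorm_le)
      fix h
      have "f' (p x) (p h) + h = (f' (p x) - f' (0, 0)) (p h)"
        by (simp add: blinfun.diff_left id p_def)
      also have "norm \<dots> \<le> norm (f' (p x) - f' (0, 0)) * norm (p h)"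
        by (rule norm_blinfun)
      also have "\<dots> \<le> 1 / (4 * K) * (norm h * K)"
        using dd[OF pm[OF x]] K by (intro mult_mono) (auto simp: dist_norm)
      finally show "norm (f' (p x) (p h) + h) \<le> 1 / 4 * norm h"
        using K(1) by simp
    qed
  qed
  have F0: "F 0 = 0" by (simp add: F_def f0)
  have \<rho>D: "cball 0 \<rho> \<subseteq> D"
    using pm(1) by (auto simp: D_def p_def)
  \<comment> \<open>The linear part contributes minus the squared distance, and the Lipschitz part
    at most a quarter of it.\<close>
  have mono: "(x - y) \<bullet> (F x - F y) \<le> 0" if "x \<in> ball 0 \<rho>" "y \<in> ball 0 \<rho>" for x y
  proof -
    have "(x - y) \<bullet> ((F x + x) - (F y + y)) \<le> norm (x - y) * norm ((F x + x) - (F y + y))"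
      by (rule norm_cauchy_schwarz)
    also have "\<dots> \<le> norm (x - y) * (1 / 4 * norm (x - y))"
      using lip that by (intro mult_left_mono) auto
    also have "\<dots> \<le> (x - y) \<bullet> (x - y)"
      by (simp add: dot_square_norm power2_eq_square)
    finally show ?thesis by (simp add: algebra_simps)
  qed
  \<comment> \<open>Existence needs \<open>2 * norm x0 \<le> \<rho>\<close>; the strict inequality
    keeps \<open>\<phi>\<close> in the open ball, where the uniqueness argument takes place.\<close>
  have main: "\<exists>\<phi>. solves_ivp F D {0..} x0 \<phi> \<and>
      (\<forall>T>0. \<forall>\<psi>. solves_ivp F D {0..<T} x0 \<psi> \<longrightarrow> (\<forall>t\<in>{0..<T}. \<psi> t = \<phi> t)) \<and>
      (\<forall>t\<ge>0. norm (\<phi> t) \<le> 2 * norm x0 * exp (- (1 / 2) * t))"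
    if x0: "norm x0 < \<rho> / 2" for x0
  proof -
    obtain \<phi> where \<phi>: "\<phi> 0 = x0"
      "\<And>t. t \<ge> 0 \<Longrightarrow> (\<phi> has_vector_derivative F (\<phi> t)) (at t within {0..})"
      "\<And>t. t \<ge> 0 \<Longrightarrow> norm (\<phi> t) \<le> 2 * norm x0 * exp (- t / 2)"
      using exists_decaying_solution[where F = F and \<rho> = \<rho> and ?x0.0 = x0, OF F0 lip] x0 by auto
    have in_ball: "\<phi> t \<in> ball 0 \<rho>" if "t \<ge> 0" for t
    proof -
      have "norm (\<phi> t) \<le> 2 * norm x0 * exp (- t / 2)" using \<phi>(3) that .
      also have "\<dots> \<le> 2 * norm x0 * 1" using that by (intro mult_left_mono) auto
      finally show ?thesis using x0 by simp
    qed
    have "solves_ivp F D {0..} x0 \<phi>"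
      using \<phi> in_ball \<rho>D by (auto simp: solves_ivp_def subset_iff less_imp_le)
    moreover have "\<psi> t = \<phi> t" if "solves_ivp F D {0..<T} x0 \<psi>" "t \<in> {0..<T}" for T \<psi> t
    proof (rule solution_unique[OF mono open_ball _ _ _ that(2)])
      show "\<phi> s \<in> ball 0 \<rho> \<and> (\<phi> has_vector_derivative F (\<phi> s)) (at s within {0..<T})"
        if "s \<in> {0..<T}" for s
        using \<phi>(2)[of s] in_ball[of s] that
        by (auto intro: has_vector_derivative_within_subset)
    qed (use that \<phi>(1) in \<open>auto simp: solves_ivp_def\<close>)
    ultimately show ?thesis using \<phi>(3) by (intro exI[of _ \<phi>]) auto
  qed
  have "C1_on UNIV w"
    unfolding C1_on_def
    by (intro exI[of _ "\<lambda>_. Blinfun w"])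
      (auto simp: bounded_linear_Blinfun_apply[OF w] intro: w.has_derivative[OF has_derivative_ident])
  moreover have "\<exists>\<alpha>>0. \<exists>M>0. \<exists>\<delta>>0. \<forall>x0. norm x0 < \<delta> \<longrightarrow>
      (\<exists>\<phi>. solves_ivp F D {0..} x0 \<phi> \<and>
      (\<forall>T>0. \<forall>\<psi>. solves_ivp F D {0..<T} x0 \<psi> \<longrightarrow> (\<forall>t\<in>{0..<T}. \<psi> t = \<phi> t)) \<and>
      (\<forall>t\<ge>0. norm (\<phi> t) \<le> M * norm x0 * exp (- \<alpha> * t)))"
    using main \<rho>
    by (intro exI[of _ "1/2::real"] conjI exI[of _ "2::real"] exI[of _ "\<rho> / 2"]) auto
  ultimately show ?thesis
    unfolding exp_stabilizing_feedback_def Let_def D_def F_def by (simp add: w.zero)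
qed

section \<open>The feedback matrix and the closed-loop linearization\<close>

text \<open>Since \<open>A ** transpose A\<close> is \<open>c\<^sup>2\<close> times
  \<open>B ** transpose B\<close>, the matrix to be inverted is \<open>c\<^sup>2 + 1\<close> times
  \<open>B ** transpose B\<close>. The scalar factor of the feedback law cancels exactly this,
  making the rest of the law a right inverse of \<open>B\<close>.\<close>

lemma pseudoinverse_if_parallel:
  fixes B :: "real^'n^'n"
  assumes "invertible B" and A: "A = - c *\<^sub>R B"
  shows "(c\<^sup>2 + 1) *\<^sub>R (B ** (transpose B ** matrix_inv (A ** transpose A + B ** transpose B)))
    = mat 1"
proof -
  let ?M = "A ** transpose A + B ** transpose B"
  have M: "?M = (c\<^sup>2 + 1) *\<^sub>R (B ** transpose B)"
    unfolding A transpose_scalar matrix_scalar_ac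
    by (simp add: power2_eq_square scaleR_add_left flip: scalar_matrix_assoc)
  have "c\<^sup>2 + 1 > 0" by (simp add: add_nonneg_pos)
  then have "invertible ?M"
    unfolding M using assms(1)
    by (intro scalar_invertible invertible_mult transpose_invertible) auto
  then have "?M ** matrix_inv ?M = mat 1"
    unfolding invertible_def matrix_inv_def by (rule someI2_ex) auto
  then show ?thesis
    by (simp add: M matrix_mul_assoc flip: scalar_matrix_assoc)
qed

theorem theorem21:
  fixes U V :: "(real^'n) set"
    and f :: "(real^'n) \<times> (real^'n) \<Rightarrow> real^'n"
    and c :: real
  defines "A \<equiv> jac_state f" and "B \<equiv> jac_control f"
  assumes "open (U \<times> V)" and "(0, 0) \<in> U \<times> V"
    and "C1_on (U \<times> V) f" and "f (0, 0) = 0"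
    and "cov (U \<times> V) f (0, 0) > 0"
    and "transversality_constant f c"
  shows "locally_exp_stabilizable U V f \<and>
    exp_stabilizing_feedback U V f UNIV
      (\<lambda>x. - (c\<^sup>2 + 1) *\<^sub>R
        ((transpose B ** matrix_inv (A ** transpose A + B ** transpose B) ** (mat 1 + A)) *v x))"
proof -
  let ?w = "\<lambda>x. - (c\<^sup>2 + 1) *\<^sub>R
        ((transpose B ** matrix_inv (A ** transpose A + B ** transpose B) ** (mat 1 + A)) *v x)"
  obtain f' where der: "\<And>z. z \<in> U \<times> V \<Longrightarrow> (f has_derivative blinfun_apply (f' z)) (at z)"
    and cont: "continuous_on (U \<times> V) f'"
    using assms(5) unfolding C1_on_def by blast
  note der0 = der[OF assms(4)]
  let ?L = "blinfun_apply (f' (0, 0))"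
  have dA: "((\<lambda>x. f (x, 0)) has_derivative (\<lambda>h. ?L (h, 0))) (at 0)"
    using has_derivative_compose[of "\<lambda>x. (x, 0)" "\<lambda>h. (h, 0)" 0 UNIV f ?L] der0
    by (simp add: has_derivative_Pair)
  have LA: "?L (h, 0) = A *v h" for h
    using has_derivative_unique[OF dA jacobian_works[THEN iffD1, OF differentiableI[OF dA]]]
    unfolding A_def jac_state_def by (rule fun_cong)
  have dB: "((\<lambda>u. f (0, u)) has_derivative (\<lambda>h. ?L (0, h))) (at 0)"
    using has_derivative_compose[of "\<lambda>u. (0, u)" "\<lambda>h. (0, h)" 0 UNIV f ?L] der0
    by (simp add: has_derivative_Pair)
  have LB: "?L (0, k) = B *v k" for k
    using has_derivative_unique[OF dB jacobian_works[THEN iffD1, OF differentiableI[OF dB]]]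
    unfolding B_def jac_control_def by (rule fun_cong)
  have L: "?L (h, k) = A *v h + B *v k" for h k
    using blinfun.add_right[of "f' (0, 0)" "(h, 0)" "(0, k)"] by (simp add: LA LB)
  have A: "A = - c *\<^sub>R B"
    using assms(8) by (simp add: transversality_constant_def A_def B_def)
  have "surj ?L"
    using assms(7) linearly_open_imp_surj_derivative[OF _ _ der0] by (auto simp: cov_pos_iff)
  \<comment> \<open>Transversality places the range of \<open>A\<close> inside that of
    \<open>B\<close>, so surjectivity of the joint derivative passes to \<open>B\<close>
    alone.\<close>
  have "\<exists>v. y = B *v v" for y
  proof -
    obtain h k where "y = ?L (h, k)"
      using surjD[OF \<open>surj ?L\<close>, of y] by auto
    also have "\<dots> = B *v (k - c *\<^sub>R h)"
      unfolding L A by (simp add: matrix_vector_mult_diff_distrib matrix_vector_mult_scaleR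
          flip: scaleR_matrix_vector_assoc scaleR_minus_left)
    finally show ?thesis by blast
  qed
  then have "surj ((*v) B)" unfolding surj_def by blast
  then have "invertible B"
    by (simp add: invertible_right_inverse matrix_right_invertible_surjective)
  \<comment> \<open>The control thus cancels \<open>A\<close> and leaves \<open>- h\<close>: the
    closed-loop derivative is \<open>A - (mat 1 + A)\<close>.\<close>
  have inv: "B *v ?w h = - (h + A *v h)" for h
  proof -
    let ?N = "B ** (transpose B ** matrix_inv (A ** transpose A + B ** transpose B))"
    have "B *v ?w h = - (c\<^sup>2 + 1) *\<^sub>R (?N *v ((mat 1 + A) *v h))"
      by (simp only: matrix_vector_mult_scaleR matrix_vector_mul_assoc matrix_mul_assoc)
    also have "\<dots> = - (((c\<^sup>2 + 1) *\<^sub>R ?N) *v ((mat 1 + A) *v h))"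
      by (simp only: scaleR_minus_left flip: scaleR_matrix_vector_assoc)
    also have "\<dots> = - (h + A *v h)"
      by (simp only: pseudoinverse_if_parallel[OF \<open>invertible B\<close> A])
        (simp add: matrix_vector_mult_add_rdistrib)
    finally show ?thesis .
  qed
  have "exp_stabilizing_feedback U V f UNIV ?w"
  proof (rule exp_stabilizing_feedback_if_derivative_minus_id[OF assms(3,4) der cont assms(6)])
    show "bounded_linear ?w"
      by (intro bounded_linear_const_scaleR matrix_vector_mul_bounded_linear)
    show "?L (h, ?w h) = - h" for h
      unfolding L inv by simp
  qed
  then show ?thesis unfolding locally_exp_stabilizable_def by (intro conjI exI)
qed

end
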